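(* Let $\alpha,\beta,\eta$ be real with $\eta>0$, $\alpha\ne-1$, $\beta\ne0$, $\alpha>-\beta-1$. Let $X$ be a random variable with the generalized gamma-type probability density function $$f_X(x;\alpha,\eta,\beta)=\frac{(\alpha+1)\,\eta^{(\alpha+1)/\beta}}{\Gamma\left((\alpha+\beta+1)/\beta\right)}\,x^\alpha e^{-\eta x^\beta},\qquad x\in\mathbb{R}^+.$$ Then the distribution function $F_X(x;\alpha,\eta,\beta)$ of $X$ is given by $$F_X(x;\alpha,\eta,\beta)=\frac{(\alpha+1)\,\eta^{(\alpha+1)/\beta}}{\Gamma\left((\alpha+\beta+1)/\beta\right)}\,x^{\alpha+1}e^{-\eta x^\beta}\;{}_1F_1\Bigl(1;\frac{\alpha+\beta+1}{\beta}; \eta x^{\beta}\Bigr),$$ and the $n$th moments $M(X^n)$ of $X$ are given by $$M(X^n)=\int_0^{+\infty} x^n f_X(x;\alpha,\eta,\beta)\,dx=\frac{\Gamma\left((\alpha+n+1)/\beta\right)}{\eta^{n/\beta}\,\Gamma\left((\alpha+1)/\beta\right)}.$$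
   Context: ${}_1F_1(a;b;x)=\sum_{n=0}^{\infty}\frac{(a)_n}{(b)_n}\frac{x^n}{n!}$, where $(\vartheta)_n=\Gamma(\vartheta+n)/\Gamma(\vartheta)$, $(\vartheta)_0=1$ (Pochhammer symbol). The distribution function is $F_X(x)=\int_0^x f_X(u)\,du$.
   Formalization: The factor (α+1) in the printed formula for the distribution function is dropped: with it the formula is false unless α=0 (for α=β=η=1 it gives twice the true value and tends to 2). The moment formula is unchanged. *)

theory Defs
  imports "HOL-Probability.Probability"
begin

text \<open>Kummer's confluent hypergeometric function; only meaningful when the lower parameter is
  not a non-positive integer.\<close>

definition hyp_1F1 :: "real \<Rightarrow> real \<Rightarrow> real \<Rightarrow> real" where
  "hyp_1F1 a b x = (\<Sum>n. pochhammer a n / pochhammer b n * (x ^ n / fact n))"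

text \<open>The density lives on the open half-line and is extended by zero. Note that integrating
  $u^\alpha$ contributes $1/(\alpha+1)$, which cancels the factor $\alpha+1$ of the normalising
  constant: that factor is therefore absent from the closed form of the distribution function.
  The source keeps it there, which is a misprint: for $\alpha=\beta=\eta=1$ it would make the
  distribution function tend to $2$.\<close>

definition gg_density :: "real \<Rightarrow> real \<Rightarrow> real \<Rightarrow> real \<Rightarrow> real" where
  "gg_density \<alpha> \<eta> \<beta> x =
     (if x > 0
      then (\<alpha> + 1) * \<eta> powr ((\<alpha> + 1) / \<beta>) / Gamma ((\<alpha> + \<beta> + 1) / \<beta>)
             * x powr \<alpha> * exp (- \<eta> * x powr \<beta>)
      else 0)"

end

theory Submission
  imports Defs "HOL-Real_Asymp.Real_Asymp"
begin

text \<open>The hypotheses only allow $\beta > 0$ and $\alpha > -1$: for $\beta < 0$ the tail of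
  $x^\alpha e^{-\eta x^\beta}$ is not integrable, and for $\alpha \le -1$ the constant
  $\alpha + 1$ makes the density non-positive. In the remaining case $h = {}_1F_1(1;b;\cdot)$
  satisfies $y h' + (b-1) h - y h = b-1$, which makes the claimed distribution function an
  antiderivative of the density. The moments come from the Gamma integral by the substitution
  $t = \eta x^\beta$.\<close>

section \<open>Kummer's function with upper parameter 1\<close>

lemma fact_le_pochhammer:
  fixes b :: real
  assumes "b \<ge> 1"
  shows "fact n \<le> pochhammer b n"
proof (induction n)
  case (Suc n)
  have "fact n * (1 + real n) \<le> pochhammer b n * (b + real n)"
    using assms Suc by (intro mult_mono) (auto simp: pochhammer_nonneg)
  then show ?case by (simp add: pochhammer_Suc algebra_simps)
qed simp

text \<open>For b \<ge> 1 the Pochhammer symbol dominates the factorial, so the exponential series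
  is a majorant for every real y.\<close>

lemma summable_inverse_pochhammer:
  fixes b :: real
  assumes "b \<ge> 1"
  shows "summable (\<lambda>n. inverse (pochhammer b n) * y ^ n)"
proof (rule summable_comparison_test')
  show "summable (\<lambda>n. inverse (fact n) * \<bar>y\<bar> ^ n)"
    by (rule summable_exp)
  show "norm (inverse (pochhammer b n) * y ^ n) \<le> inverse (fact n) * \<bar>y\<bar> ^ n" if "n \<ge> 0" for n
  proof -
    have "pochhammer b n > 0" using assms by (intro pochhammer_pos) auto
    moreover have "inverse (pochhammer b n) \<le> inverse (fact n)"
      using fact_le_pochhammer[OF assms] by (intro le_imp_inverse_le) auto
    ultimately show ?thesis
      by (auto simp: abs_mult power_abs intro!: mult_right_mono)
  qed
qed

text \<open>The upper parameter 1 gives \<open>pochhammer 1 n = fact n\<close>, which cancels the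
  factorial in the denominator.\<close>

lemma hyp_1F1_one_eq: "hyp_1F1 1 b y = (\<Sum>n. inverse (pochhammer b n) * y ^ n)"
  unfolding hyp_1F1_def by (simp add: field_simps flip: pochhammer_fact)

text \<open>Comparing coefficients reduces the equation to the recurrence (b + n) c(n+1) = c(n). It
  is first order because Kummer's second-order equation with upper parameter 1 is an exact
  derivative; b - 1 is the constant of integration, read off at y = 0.\<close>

lemma hyp_1F1_one_ode:
  assumes "b > 1"
  obtains h' where "(hyp_1F1 1 b has_real_derivative h') (at y)"
    and "y * h' + (b - 1) * hyp_1F1 1 b y - y * hyp_1F1 1 b y = b - 1"
proof -
  define c where "c n = inverse (pochhammer b n)" for n
  have sm: "summable (\<lambda>n. c n * z ^ n)" for z
    unfolding c_def using assms by (intro summable_inverse_pochhammer) auto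
  have h: "hyp_1F1 1 b = (\<lambda>z. \<Sum>n. c n * z ^ n)"
    by (auto simp: c_def hyp_1F1_one_eq)
  define h' where "h' = (\<Sum>n. diffs c n * y ^ n)"
  have der: "(hyp_1F1 1 b has_real_derivative h') (at y)"
    unfolding h h'_def by (rule termdiffs_strong_converges_everywhere) (rule sm)
  have s0: "(\<lambda>n. c n * y ^ n) sums hyp_1F1 1 b y"
    unfolding h using sm by (rule summable_sums)
  have "(\<lambda>n. diffs c n * y ^ n) sums h'"
    using termdiffs_sums_strong[of "\<bar>y\<bar> + 1" c "hyp_1F1 1 b" h' y] sm der
    by (auto simp: h intro: summable_sums)
  from sums_mult[OF this, of y]
  have "(\<lambda>n. real (Suc n) * c (Suc n) * y ^ Suc n) sums (y * h')"
    by (simp add: diffs_def mult_ac)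
  \<comment> \<open>The shift back to index 0 leaves the sum unchanged, since the term with n = 0
    carries the factor n.\<close>
  then have s1: "(\<lambda>n. real n * c n * y ^ n) sums (y * h')"
    by (subst (asm) sums_Suc_iff) simp
  have "(\<lambda>n. real n * c n * y ^ n + (b - 1) * (c n * y ^ n))
          sums (y * h' + (b - 1) * hyp_1F1 1 b y)"
    by (intro sums_add s1 sums_mult s0)
  \<comment> \<open>Here the dropped term is (b - 1) c(0) = b - 1, which produces the inhomogeneous
    side of the equation.\<close>
  then have "(\<lambda>n. real (Suc n) * c (Suc n) * y ^ Suc n + (b - 1) * (c (Suc n) * y ^ Suc n))
          sums (y * h' + (b - 1) * hyp_1F1 1 b y - (b - 1))"
    by (subst sums_Suc_iff) (simp add: c_def)
  moreover have "real (Suc n) * c (Suc n) * y ^ Suc n + (b - 1) * (c (Suc n) * y ^ Suc n)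
          = y * (c n * y ^ n)" for n
  proof -
    have p: "pochhammer b n > 0" "b + real n > 0"
      using assms by (auto intro!: pochhammer_pos)
    have "(b + real n) * c (Suc n) = c n"
      using p by (simp add: c_def pochhammer_Suc)
    moreover have "real (Suc n) * c (Suc n) * y ^ Suc n + (b - 1) * (c (Suc n) * y ^ Suc n)
          = ((b + real n) * c (Suc n)) * y ^ Suc n"
      by (simp add: algebra_simps)
    ultimately show ?thesis by simp
  qed
  ultimately have "(\<lambda>n. y * (c n * y ^ n)) sums (y * h' + (b - 1) * hyp_1F1 1 b y - (b - 1))"
    by simp
  with sums_mult[OF s0, of y]
  have "y * hyp_1F1 1 b y = y * h' + (b - 1) * hyp_1F1 1 b y - (b - 1)"
    by (rule sums_unique2)
  with der show ?thesis by (intro that) (auto simp: algebra_simps)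
qed

section \<open>Lebesgue integrals and the signs of the parameters\<close>

lemma has_integral_lborel_nonneg:
  fixes f :: "real \<Rightarrow> real"
  assumes "(f has_integral I) S" "\<And>x. x \<in> S \<Longrightarrow> 0 \<le> f x"
    and "f \<in> borel_measurable borel" "S \<in> sets borel"
  shows "set_integrable lborel S f" and "(LBINT x:S. f x) = I"
proof -
  \<comment> \<open>Nonnegativity makes the gauge integral absolute. Borel measurability then
    permits the descent from completed Lebesgue measure to \<open>lborel\<close>.\<close>
  have "f absolutely_integrable_on S"
    using assms by (intro nonnegative_absolutely_integrable_1) auto
  then show *: "set_integrable lborel S f"
    using assms unfolding set_integrable_def by (subst (asm) integrable_completion) auto
  show "(LBINT x:S. f x) = I"
    using set_borel_integral_eq_integral(2)[OF *] assms(1) by (simp add: integral_unique)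
qed

lemma measurable_gg_density [measurable]: "gg_density \<alpha> \<eta> \<beta> \<in> borel_measurable borel"
  unfolding gg_density_def by measurable

text \<open>For \<beta> < 0 the exponential tends to 1 at infinity, so the integrand behaves like a
  power with exponent above -1. A single block [T, 2T] with T large already has mass greater than 1,
  which is enough to contradict normalisation.\<close>

lemma nn_integral_powr_exp_infinite:
  fixes \<alpha> \<beta> \<eta> C :: real
  assumes "\<alpha> > -1" "\<beta> < 0" "\<eta> > 0" "C > 0"
    and f: "\<And>x. x > 0 \<Longrightarrow> f x = C * x powr \<alpha> * exp (- \<eta> * x powr \<beta>)"
    and [measurable]: "f \<in> borel_measurable borel"
  shows "(\<integral>\<^sup>+x. ennreal (f x) \<partial>lborel) \<noteq> 1"
proof
  assume eq: "(\<integral>\<^sup>+x. ennreal (f x) \<partial>lborel) = 1"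
  \<comment> \<open>For x \<ge> 1 the exponential is at least exp(-\<eta>), since x^\<beta> \<le> 1;
    the factor 1/2 comes from x \<le> 2T.\<close>
  define K where "K = C * exp (- \<eta>) / 2"
  have "K > 0" using assms by (simp add: K_def)
  have "filterlim (\<lambda>T. K * T powr (\<alpha> + 1)) at_top at_top"
    using assms \<open>K > 0\<close> by real_asymp
  then have "eventually (\<lambda>T. K * T powr (\<alpha> + 1) > 1 \<and> T \<ge> 1) at_top"
    by (intro eventually_conj eventually_ge_at_top) (auto simp: filterlim_at_top_dense)
  then obtain T where T: "K * T powr (\<alpha> + 1) > 1" "T \<ge> 1"
    using eventually_happens[of _ "at_top :: real filter"] by auto
  have low: "K * T powr (\<alpha> + 1) / T \<le> f x" if x: "x \<in> {T..2*T}" for x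
  proof -
    have "x powr \<beta> \<le> 1"
      using x T assms powr_mono[of \<beta> 0 x] by auto
    then have e: "exp (- \<eta>) \<le> exp (- \<eta> * x powr \<beta>)"
      using assms by simp
    \<comment> \<open>Writing x^\<alpha> as x^(\<alpha>+1) / x gives a numerator that increases in x
      whatever the sign of \<alpha>.\<close>
    have "T powr (\<alpha> + 1) / (2 * T) \<le> x powr (\<alpha> + 1) / x"
      using x T assms by (intro frac_le powr_mono2) auto
    also have "\<dots> = x powr \<alpha>" using x T by (simp add: powr_add)
    finally have "C * (T powr (\<alpha> + 1) / (2 * T)) * exp (- \<eta>)
        \<le> C * x powr \<alpha> * exp (- \<eta> * x powr \<beta>)"
      using e assms T by (intro mult_mono) auto
    then show ?thesis using f[of x] x T by (simp add: K_def field_simps)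
  qed
  have "ennreal (K * T powr (\<alpha> + 1)) = ennreal (K * T powr (\<alpha> + 1) / T) * ennreal T"
    using T \<open>K > 0\<close> by (subst ennreal_mult[symmetric]) auto
  also have "\<dots> = (\<integral>\<^sup>+x. ennreal (K * T powr (\<alpha> + 1) / T) * indicator {T..2*T} x \<partial>lborel)"
    using T by (subst nn_integral_cmult_indicator) auto
  also have "\<dots> \<le> (\<integral>\<^sup>+x. ennreal (f x) \<partial>lborel)"
    using low by (intro nn_integral_mono) (auto simp: indicator_def intro!: ennreal_leI)
  finally show False using T eq by (simp add: ennreal_le_1)
qed

text \<open>Total mass 1 forces C > 0. If \<beta> < 0, then \<alpha> > -\<beta> - 1 gives \<alpha> >
  -1 and the mass on a far block is too large. Once \<beta> > 0, the Gamma value in C is positive,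
  so C has the sign of \<alpha> + 1.\<close>

lemma gg_density_normalised_imp_pos:
  assumes "\<eta> > 0" "\<beta> \<noteq> 0" "\<alpha> > - \<beta> - 1"
    and int: "(\<integral>\<^sup>+x. ennreal (gg_density \<alpha> \<eta> \<beta> x) \<partial>lborel) = 1"
  shows "\<beta> > 0" and "\<alpha> > -1"
proof -
  define C where "C = (\<alpha> + 1) * \<eta> powr ((\<alpha> + 1) / \<beta>) / Gamma ((\<alpha> + \<beta> + 1) / \<beta>)"
  have eq: "gg_density \<alpha> \<eta> \<beta> x = C * x powr \<alpha> * exp (- \<eta> * x powr \<beta>)" if "x > 0" for x
    using that by (simp add: gg_density_def C_def)
  have C: "C > 0"
  proof (rule ccontr)
    assume "\<not> C > 0"
    then have "gg_density \<alpha> \<eta> \<beta> x \<le> 0" for x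
      using eq[of x] by (cases "x > 0") (auto simp: mult_nonpos_nonneg gg_density_def)
    \<comment> \<open>The coercion \<open>ennreal\<close> sends nonpositive reals to 0, so a
      nonpositive density has mass 0.\<close>
    then have "(\<integral>\<^sup>+x. ennreal (gg_density \<alpha> \<eta> \<beta> x) \<partial>lborel) = 0"
      by (simp add: ennreal_neg)
    with int show False by simp
  qed
  show \<beta>: "\<beta> > 0"
  proof (rule ccontr)
    assume "\<not> \<beta> > 0"
    with assms have "\<beta> < 0" "\<alpha> > -1" by auto
    from nn_integral_powr_exp_infinite[OF this(2,1) assms(1) C eq] int show False by simp
  qed
  have "Gamma ((\<alpha> + \<beta> + 1) / \<beta>) > 0"
    using \<beta> assms by (intro Gamma_real_pos divide_pos_pos) auto
  with C have "\<alpha> + 1 > 0"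
    using assms by (auto simp: C_def zero_less_mult_iff zero_less_divide_iff)
  then show "\<alpha> > -1" by simp
qed

section \<open>The Gamma integral and the moments\<close>

lemma has_integral_powr_exp_powr:
  fixes a \<beta> \<eta> :: real
  assumes "a > 0" "\<beta> > 0" "\<eta> > 0"
  shows "((\<lambda>x. x powr (a - 1) * exp (- \<eta> * x powr \<beta>)) has_integral
           Gamma (a / \<beta>) / (\<beta> * \<eta> powr (a / \<beta>))) {0<..}"
proof -
  \<comment> \<open>Under t = \<eta> x^\<beta> the product t^(s-1) dt carries the power
    x^(\<beta>(s-1) + \<beta> - 1), which is x^(a-1) for this s.\<close>
  define s where "s = a / \<beta>"
  have s: "s > 0" "a = s * \<beta>" using assms by (auto simp: s_def)
  define f where "f t = t powr (s - 1) / exp t" for t :: real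
  define g where "g x = \<eta> * x powr \<beta>" for x :: real
  define g' where "g' x = \<eta> * (\<beta> * x powr (\<beta> - 1))" for x :: real
  have img: "g ` {0<..} = {0<..}"
  proof (intro equalityI subsetI)
    fix t :: real assume t: "t \<in> {0<..}"
    have "g ((t / \<eta>) powr (1 / \<beta>)) = t"
      using t assms by (simp add: g_def powr_powr)
    then show "t \<in> g ` {0<..}"
      using t assms by (intro image_eqI[of _ _ "(t / \<eta>) powr (1 / \<beta>)"]) auto
  qed (use assms in \<open>auto simp: g_def\<close>)
  have inj: "inj_on g {0<..}"
  proof (rule inj_onI)
    fix x y :: real assume "x \<in> {0<..}" "y \<in> {0<..}" "g x = g y"
    then have "(x powr \<beta>) powr (1 / \<beta>) = (y powr \<beta>) powr (1 / \<beta>)"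
      using assms by (simp add: g_def)
    then show "x = y" using assms \<open>x \<in> {0<..}\<close> \<open>y \<in> {0<..}\<close> by (simp add: powr_powr)
  qed
  have "(f has_integral Gamma s) {0..}"
    unfolding f_def by (rule Gamma_integral_real) fact
  \<comment> \<open>The origin is removed because x^\<beta> need not be differentiable there, and
    the change of variables asks for a derivative at every point.\<close>
  then have "(f has_integral Gamma s) {0<..}"
    by (rule has_integral_spike_set_eq[THEN iffD1, rotated -1])
       (auto intro: negligible_subset[of "{0}"])
  then have "f absolutely_integrable_on g ` {0<..} \<and> integral (g ` {0<..}) f = Gamma s"
    unfolding img by (auto intro!: nonnegative_absolutely_integrable_1 simp: f_def integral_unique)
  moreover have "(g has_field_derivative g' x) (at x within {0<..})" if "x \<in> {0<..}" for x
    unfolding g_def g'_def using that by (auto intro!: derivative_eq_intros)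
  ultimately have "(\<lambda>x. \<bar>g' x\<bar> * f (g x)) absolutely_integrable_on {0<..} \<and>
           integral {0<..} (\<lambda>x. \<bar>g' x\<bar> * f (g x)) = Gamma s"
    using inj by (subst has_absolute_integral_change_of_variables_1'[of _ g g' f]) auto
  then have "((\<lambda>x. \<bar>g' x\<bar> * f (g x)) has_integral Gamma s) {0<..}"
    using absolutely_integrable_on_def has_integral_integral by (metis set_lebesgue_integral_eq_integral(1))
  then have "((\<lambda>x. \<bar>g' x\<bar> * f (g x) / (\<beta> * \<eta> powr s)) has_integral Gamma s / (\<beta> * \<eta> powr s)) {0<..}"
    by (rule has_integral_divide)
  then show ?thesis
    unfolding s_def[symmetric]
  proof (rule has_integral_eq[rotated])
    fix x :: real assume x: "x \<in> {0<..}"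
    have "\<bar>g' x\<bar> * f (g x) = \<beta> * (\<eta> * \<eta> powr (s - 1)) * (x powr (\<beta> - 1) * x powr (\<beta> * (s - 1)))
            * exp (- \<eta> * x powr \<beta>)"
      using x assms by (simp add: g'_def f_def g_def powr_mult powr_powr exp_minus field_simps)
    also have "\<eta> * \<eta> powr (s - 1) = \<eta> powr s"
      using assms by (simp add: powr_diff)
    also have "x powr (\<beta> - 1) * x powr (\<beta> * (s - 1)) = x powr (a - 1)"
      by (subst powr_add[symmetric]) (simp add: s algebra_simps)
    finally show "\<bar>g' x\<bar> * f (g x) / (\<beta> * \<eta> powr s) = x powr (a - 1) * exp (- \<eta> * x powr \<beta>)"
      using assms by simp
  qed
qed

lemma gg_density_nonneg:
  assumes "\<beta> > 0" "\<alpha> > -1"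
  shows "gg_density \<alpha> \<eta> \<beta> x \<ge> 0"
  using assms unfolding gg_density_def
  by (auto intro!: mult_nonneg_nonneg divide_nonneg_nonneg less_imp_le[OF Gamma_real_pos])

text \<open>The factor x^n only shifts the exponent of the density, so the preceding integral
  applies with a = \<alpha> + n + 1. The powers of \<eta> cancel up to \<eta>^(n/\<beta>).\<close>

lemma gg_density_moment_has_integral:
  assumes "\<eta> > 0" "\<beta> > 0" "\<alpha> > -1"
  shows "((\<lambda>x. x ^ n * gg_density \<alpha> \<eta> \<beta> x) has_integral
           Gamma ((\<alpha> + real n + 1) / \<beta>) / (\<eta> powr (real n / \<beta>) * Gamma ((\<alpha> + 1) / \<beta>))) {0<..}"
proof -
  define C where "C = (\<alpha> + 1) * \<eta> powr ((\<alpha> + 1) / \<beta>) / Gamma ((\<alpha> + \<beta> + 1) / \<beta>)"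
  define a where "a = \<alpha> + real n + 1"
  have G: "Gamma ((\<alpha> + 1) / \<beta>) > 0" using assms by (intro Gamma_real_pos) auto
  \<comment> \<open>The functional equation of Gamma removes \<alpha> + 1 from the normalising
    constant and leaves the Gamma value of the moment formula.\<close>
  have "Gamma ((\<alpha> + 1) / \<beta> + 1) = (\<alpha> + 1) / \<beta> * Gamma ((\<alpha> + 1) / \<beta>)"
    using assms by (intro Gamma_plus1) (auto dest: nonpos_Ints_nonpos simp: field_simps)
  moreover have "(\<alpha> + \<beta> + 1) / \<beta> = (\<alpha> + 1) / \<beta> + 1"
    using assms by (simp add: field_simps)
  ultimately have C: "C = \<beta> * \<eta> powr ((\<alpha> + 1) / \<beta>) / Gamma ((\<alpha> + 1) / \<beta>)"
    using assms G by (simp add: C_def)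
  have "((\<lambda>x. C * (x powr (a - 1) * exp (- \<eta> * x powr \<beta>))) has_integral
           C * (Gamma (a / \<beta>) / (\<beta> * \<eta> powr (a / \<beta>)))) {0<..}"
    using assms by (intro has_integral_mult_right has_integral_powr_exp_powr) (auto simp: a_def)
  moreover have "C * (x powr (a - 1) * exp (- \<eta> * x powr \<beta>)) = x ^ n * gg_density \<alpha> \<eta> \<beta> x"
    if "x \<in> {0<..}" for x
    using that by (simp add: gg_density_def C_def a_def powr_add powr_realpow)
  moreover have "C * (Gamma (a / \<beta>) / (\<beta> * \<eta> powr (a / \<beta>)))
      = Gamma ((\<alpha> + real n + 1) / \<beta>) / (\<eta> powr (real n / \<beta>) * Gamma ((\<alpha> + 1) / \<beta>))"
  proof -
    have "a / \<beta> = (\<alpha> + 1) / \<beta> + real n / \<beta>"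
      by (simp add: a_def add_divide_distrib)
    then have "\<eta> powr (a / \<beta>) = \<eta> powr ((\<alpha> + 1) / \<beta>) * \<eta> powr (real n / \<beta>)"
      by (simp only: powr_add)
    then show ?thesis using assms G by (simp add: C a_def field_simps)
  qed
  ultimately show ?thesis
    by (metis (no_types, lifting) has_integral_eq)
qed

section \<open>The distribution function as an antiderivative\<close>

lemma gg_density_has_integral_interval:
  assumes "\<eta> > 0" "\<beta> > 0" "\<alpha> > -1" "x > 0"
  shows "(gg_density \<alpha> \<eta> \<beta> has_integral
           \<eta> powr ((\<alpha> + 1) / \<beta>) / Gamma ((\<alpha> + \<beta> + 1) / \<beta>)
               * x powr (\<alpha> + 1) * exp (- \<eta> * x powr \<beta>)
               * hyp_1F1 1 ((\<alpha> + \<beta> + 1) / \<beta>) (\<eta> * x powr \<beta>)) {0..x}"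
proof -
  define b where "b = (\<alpha> + \<beta> + 1) / \<beta>"
  define K where "K = \<eta> powr ((\<alpha> + 1) / \<beta>) / Gamma b"
  define F where "F u = K * u powr (\<alpha> + 1) * exp (- \<eta> * u powr \<beta>) * hyp_1F1 1 b (\<eta> * u powr \<beta>)" for u
  \<comment> \<open>The second identity matches the two sides: it turns the exponent \<alpha> + 1
    from the power rule into \<beta>(b - 1), and later the constant b - 1 of the equation back into
    the factor \<alpha> + 1 of the density.\<close>
  have b: "b > 1" "\<beta> * (b - 1) = \<alpha> + 1" using assms by (auto simp: b_def field_simps)
  have der: "(F has_real_derivative gg_density \<alpha> \<eta> \<beta> u) (at u)" if u: "u > 0" for u
  proof -
    define y where "y = \<eta> * u powr \<beta>"
    obtain h' where h': "(hyp_1F1 1 b has_real_derivative h') (at y)"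
      and ode: "y * h' + (b - 1) * hyp_1F1 1 b y - y * hyp_1F1 1 b y = b - 1"
      using hyp_1F1_one_ode[OF b(1)] by blast
    define h where "h = hyp_1F1 1 b y"
    have dy: "((\<lambda>u. \<eta> * u powr \<beta>) has_real_derivative \<beta> * y / u) (at u)"
      using u by (auto intro!: derivative_eq_intros simp: y_def powr_diff)
    have dh: "((\<lambda>u. hyp_1F1 1 b (\<eta> * u powr \<beta>)) has_real_derivative h' * (\<beta> * y / u)) (at u)"
      using DERIV_chain2[OF h'[unfolded y_def] dy] .
    have de: "((\<lambda>u. exp (- \<eta> * u powr \<beta>)) has_real_derivative - exp (- y) * (\<beta> * y / u)) (at u)"
      using DERIV_chain2[OF DERIV_exp DERIV_minus[OF dy]] by (simp add: y_def)
    have dp: "((\<lambda>u. K * u powr (\<alpha> + 1)) has_real_derivative K * ((\<alpha> + 1) * u powr \<alpha>)) (at u)"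
      using u by (auto intro!: derivative_eq_intros)
    have pu: "u powr (\<alpha> + 1) = u * u powr \<alpha>" using u by (simp add: powr_add)
    have "(F has_real_derivative
        K * ((\<alpha> + 1) * u powr \<alpha>) * exp (- y) * h
        + K * u powr (\<alpha> + 1) * (- exp (- y) * (\<beta> * y / u)) * h
        + K * u powr (\<alpha> + 1) * exp (- y) * (h' * (\<beta> * y / u))) (at u)"
      unfolding F_def using DERIV_mult[OF DERIV_mult[OF dp de] dh]
      by (simp add: y_def h_def algebra_simps)
    \<comment> \<open>After the common factor is taken out, differentiating the power, the
      exponential and the Kummer function yields (b-1)h, -yh and yh' respectively: the left side of
      the differential equation.\<close>
    also have "K * ((\<alpha> + 1) * u powr \<alpha>) * exp (- y) * h
        + K * u powr (\<alpha> + 1) * (- exp (- y) * (\<beta> * y / u)) * h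
        + K * u powr (\<alpha> + 1) * exp (- y) * (h' * (\<beta> * y / u))
      = K * u powr \<alpha> * exp (- y) * (\<beta> * (y * h' + (b - 1) * h - y * h))"
      using u unfolding pu unfolding b(2)[symmetric] by (simp add: field_simps)
    also have "\<dots> = gg_density \<alpha> \<eta> \<beta> u"
      using u unfolding ode[folded h_def] b(2)
      by (simp add: gg_density_def K_def b_def y_def)
    finally show ?thesis .
  qed
  \<comment> \<open>Continuity at the left endpoint rests on the positive exponents \<beta> and
    \<alpha> + 1.\<close>
  have cont: "continuous_on {0..x} F"
  proof -
    have "isCont (hyp_1F1 1 b) y" for y
      using hyp_1F1_one_ode[OF b(1), of y] by (meson DERIV_isCont)
    then have "continuous_on UNIV (hyp_1F1 1 b)"
      by (simp add: continuous_on_eq_continuous_at)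
    then have "continuous_on {0..x} (\<lambda>u. hyp_1F1 1 b (\<eta> * u powr \<beta>))"
      by (rule continuous_on_compose2)
         (use assms in \<open>auto intro!: continuous_intros continuous_on_powr'\<close>)
    then show ?thesis
      unfolding F_def by (intro continuous_intros continuous_on_powr') (use assms in auto)
  qed
  \<comment> \<open>The interior version is used because \<open>F\<close> need not be differentiable
    at 0, for instance when \<alpha> < 0. The term \<open>F 0\<close> vanishes through the factor
    \<open>0 powr (\<alpha> + 1)\<close>.\<close>
  have "(gg_density \<alpha> \<eta> \<beta> has_integral F x - F 0) {0..x}"
    using assms der cont
    by (intro fundamental_theorem_of_calculus_interior)
       (auto simp: has_real_derivative_iff_has_vector_derivative[symmetric])
  then show ?thesis by (simp add: F_def K_def b_def)
qed

section \<open>Transfer to the random variable\<close>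

theorem theorem8:
  fixes \<alpha> \<beta> \<eta> :: real
    and M :: "'a measure" and X :: "'a \<Rightarrow> real"
  assumes "\<eta> > 0" and "\<alpha> \<noteq> -1" and "\<beta> \<noteq> 0" and "\<alpha> > - \<beta> - 1"
    and "prob_space M"
    and "distributed M lborel X (\<lambda>x. ennreal (gg_density \<alpha> \<eta> \<beta> x))"
  shows "(\<forall>x>0.
           cdf (distr M borel X) x = (LBINT u:{0..x}. gg_density \<alpha> \<eta> \<beta> u) \<and>
           cdf (distr M borel X) x =
             \<eta> powr ((\<alpha> + 1) / \<beta>) / Gamma ((\<alpha> + \<beta> + 1) / \<beta>)
               * x powr (\<alpha> + 1) * exp (- \<eta> * x powr \<beta>)
               * hyp_1F1 1 ((\<alpha> + \<beta> + 1) / \<beta>) (\<eta> * x powr \<beta>)) \<and>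
         (\<forall>n::nat.
           integrable M (\<lambda>\<omega>. X \<omega> ^ n) \<and>
           prob_space.expectation M (\<lambda>\<omega>. X \<omega> ^ n)
             = (LBINT x:{0<..}. x ^ n * gg_density \<alpha> \<eta> \<beta> x) \<and>
           (LBINT x:{0<..}. x ^ n * gg_density \<alpha> \<eta> \<beta> x)
             = Gamma ((\<alpha> + real n + 1) / \<beta>)
                 / (\<eta> powr (real n / \<beta>) * Gamma ((\<alpha> + 1) / \<beta>)))"
proof -
  interpret prob_space M by fact
  let ?f = "gg_density \<alpha> \<eta> \<beta>"
  note D = assms(6)
  \<comment> \<open>The existence of X on a probability space normalises the density, and this
    yields the sign conditions.\<close>
  have "(\<integral>\<^sup>+x. ennreal (?f x) \<partial>lborel) = 1"
    using distributed_nn_integral[OF D, of "\<lambda>_. 1"] emeasure_space_1 by simp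
  from gg_density_normalised_imp_pos[OF assms(1,3,4) this]
  have pos: "\<beta> > 0" "\<alpha> > -1" .
  note nonneg = gg_density_nonneg[OF pos]
  have X: "X \<in> borel_measurable M"
    using distributed_measurable[OF D] by simp
  have cdf: "cdf (distr M borel X) x = (LBINT u:{0..x}. ?f u)" for x
  proof -
    have "cdf (distr M borel X) x = (\<integral>\<omega>. indicator {..x} (X \<omega>) \<partial>M)"
      using X by (simp add: cdf_def measure_distr indicator_vimage[symmetric] flip: indicator_inter_arith)
    also have "\<dots> = (\<integral>u. ?f u * indicator {..x} u \<partial>lborel)"
      using nonneg by (intro distributed_integral[OF D, symmetric]) auto
    \<comment> \<open>The density vanishes on the negative half-line, so the lower limit may be cut
      at 0.\<close>
    also have "\<dots> = (LBINT u:{0..x}. ?f u)"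
      unfolding set_lebesgue_integral_def
      by (intro Bochner_Integration.integral_cong) (auto simp: gg_density_def indicator_def)
    finally show ?thesis .
  qed
  have F: "(LBINT u:{0..x}. ?f u) = \<eta> powr ((\<alpha> + 1) / \<beta>) / Gamma ((\<alpha> + \<beta> + 1) / \<beta>)
               * x powr (\<alpha> + 1) * exp (- \<eta> * x powr \<beta>)
               * hyp_1F1 1 ((\<alpha> + \<beta> + 1) / \<beta>) (\<eta> * x powr \<beta>)" if "x > 0" for x
    using nonneg
    by (intro has_integral_lborel_nonneg gg_density_has_integral_interval assms pos that) auto
  have mom: "integrable M (\<lambda>\<omega>. X \<omega> ^ n)"
      "expectation (\<lambda>\<omega>. X \<omega> ^ n) = (LBINT x:{0<..}. x ^ n * ?f x)"
      "(LBINT x:{0<..}. x ^ n * ?f x) = Gamma ((\<alpha> + real n + 1) / \<beta>)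
                 / (\<eta> powr (real n / \<beta>) * Gamma ((\<alpha> + 1) / \<beta>))" for n
  proof -
    note I = has_integral_lborel_nonneg[OF gg_density_moment_has_integral[OF assms(1) pos, of n]]
    \<comment> \<open>The transfer rules integrate over the whole line; extension by zero identifies
      this with the integral over the open half-line.\<close>
    have eq: "?f x * x ^ n = indicator {0<..} x *\<^sub>R (x ^ n * ?f x)" for x
      by (auto simp: gg_density_def indicator_def)
    show "(LBINT x:{0<..}. x ^ n * ?f x) = Gamma ((\<alpha> + real n + 1) / \<beta>)
                 / (\<eta> powr (real n / \<beta>) * Gamma ((\<alpha> + 1) / \<beta>))"
      using nonneg by (intro I(2)) auto
    have "set_integrable lborel {0<..} (\<lambda>x. x ^ n * ?f x)"
      using nonneg by (intro I(1)) auto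
    then show "integrable M (\<lambda>\<omega>. X \<omega> ^ n)"
      using nonneg distributed_integrable[OF D, of "\<lambda>x. x ^ n"]
      by (simp add: set_integrable_def eq)
    show "expectation (\<lambda>\<omega>. X \<omega> ^ n) = (LBINT x:{0<..}. x ^ n * ?f x)"
      using nonneg distributed_integral[OF D, of "\<lambda>x. x ^ n"]
      by (simp add: set_lebesgue_integral_def eq)
  qed
  show ?thesis
    using cdf F mom by auto
qed

end
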